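(* Let $R$ be a commutative ring with non-zero identity, let $I$ be a proper ideal of $R$, and let $n\ge 2$ be an integer. Let $P$ be an ideal of $R$ with $\sqrt{I\sqrt{P}}\subseteq IP$. If $\sqrt{P}$ is an $(n-1)$-absorbing ideal of $R$, then $P$ is an $n$-absorbing $I$-primary ideal of $R$.
   Context: For an ideal $P$ of a commutative ring $R$, $\sqrt{P}$ denotes the radical of $P$. The notation $b_1\cdots\widehat{b_i}\cdots b_m$ means that the factor $b_i$ is omitted from the product $b_1\cdots b_m$. $P - IP$ denotes set difference. For an integer $k\ge 1$, a proper ideal $Q$ of $R$ is called $k$-absorbing if whenever a product of $k+1$ elements of $R$ lies in $Q$, the product of some $k$ of these elements lies in $Q$. For a fixed proper ideal $I$ of $R$ and an integer $n \ge 1$, a proper ideal $P$ of $R$ is called an $n$-absorbing $I$-primary ideal if whenever $b_1,\dots,b_{n+1}\in R$ satisfy $b_1\cdots b_{n+1}\in P - IP$, then $b_1\cdots b_n\in P$ or $b_1\cdots\widehat{b_i}\cdots b_{n+1}\in\sqrt{P}$ for some $i\in\{1,\dots,n\}$. *)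

theory Defs
  imports "HOL-Algebra.Ideal_Product"
begin

definition radical :: "('a, 'b) ring_scheme \<Rightarrow> 'a set \<Rightarrow> 'a set" where
  "radical R P = {x \<in> carrier R. \<exists>k::nat. 1 \<le> k \<and> x [^]\<^bsub>R\<^esub> k \<in> P}"

definition proper_ideal :: "'a set \<Rightarrow> ('a, 'b) ring_scheme \<Rightarrow> bool" where
  "proper_ideal Q R \<longleftrightarrow> ideal Q R \<and> Q \<noteq> carrier R"

(* In the next two definitions b is a family indexed by {1..k + 1} resp. {1..n + 1}, so the
   elements may repeat. "Some k of these elements" is a choice of k indices. The notions are
   meant for k \<ge> 1 and n \<ge> 1, and I is meant to be a proper ideal. *)
definition absorbing_ideal :: "nat \<Rightarrow> 'a set \<Rightarrow> ('a, 'b) ring_scheme \<Rightarrow> bool" where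
  "absorbing_ideal k Q R \<longleftrightarrow> proper_ideal Q R \<and>
     (\<forall>b \<in> {1..k + 1} \<rightarrow> carrier R.
        (\<Otimes>\<^bsub>R\<^esub>j\<in>{1..k + 1}. b j) \<in> Q \<longrightarrow>
        (\<exists>S. S \<subseteq> {1..k + 1} \<and> card S = k \<and> (\<Otimes>\<^bsub>R\<^esub>j\<in>S. b j) \<in> Q))"

definition absorbing_primary_ideal ::
    "nat \<Rightarrow> 'a set \<Rightarrow> 'a set \<Rightarrow> ('a, 'b) ring_scheme \<Rightarrow> bool" where
  "absorbing_primary_ideal n I P R \<longleftrightarrow> proper_ideal P R \<and>
     (\<forall>b \<in> {1..n + 1} \<rightarrow> carrier R.
        (\<Otimes>\<^bsub>R\<^esub>j\<in>{1..n + 1}. b j) \<in> P - I \<cdot>\<^bsub>R\<^esub> P \<longrightarrow>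
        (\<Otimes>\<^bsub>R\<^esub>j\<in>{1..n}. b j) \<in> P \<or>
        (\<exists>i \<in> {1..n}. (\<Otimes>\<^bsub>R\<^esub>j\<in>{1..n + 1} - {i}. b j) \<in> radical R P))"

end

theory Submission
  imports Defs
begin

text \<open>
  Put \<open>Q = \<surd>P\<close>. If a product of \<open>n + 1\<close> elements lies in \<open>P\<close>, it lies in \<open>Q\<close>. Multiplying the last
  two factors together turns it into a product of \<open>n\<close> elements, and since \<open>Q\<close> is
  \<open>(n - 1)\<close>-absorbing, one of these \<open>n\<close> factors may be dropped. If the dropped factor is \<open>b\<^sub>i\<close> with
  \<open>i < n\<close>, this is the required conclusion for \<open>i\<close>. If it is the merged factor \<open>b\<^sub>n b\<^sub>n\<^sub>+\<^sub>1\<close>, then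
  multiplying back by \<open>b\<^sub>n\<^sub>+\<^sub>1\<close> stays in \<open>Q\<close>, which gives the conclusion for \<open>i = n\<close>. In this way the
  dropped index is never \<open>n + 1\<close>.
\<close>

lemma subset_radical:
  assumes "ideal P R"
  shows "P \<subseteq> radical R P"
proof
  interpret ideal P R by fact
  fix x assume "x \<in> P"
  then have "x \<in> carrier R" "x [^]\<^bsub>R\<^esub> (1::nat) \<in> P"
    by (auto simp: a_Hcarr)
  then show "x \<in> radical R P"
    unfolding radical_def by blast
qed

text \<open>
  Absorption is applied to the \<open>k + 1\<close> elements left after merging the factors \<open>k + 1\<close> and
  \<open>k + 2\<close>. Merging makes these two factors stand or fall together, so the last one is never the
  only one dropped.
\<close>

lemma absorbing_ideal_omit_not_last:
  fixes R (structure)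
  assumes "cring R" and Q: "absorbing_ideal k Q R"
    and b: "b \<in> {1..k + 2} \<rightarrow> carrier R"
    and prod: "(\<Otimes>j\<in>{1..k + 2}. b j) \<in> Q"
  shows "\<exists>i \<in> {1..k + 1}. (\<Otimes>j\<in>{1..k + 2} - {i}. b j) \<in> Q"
proof -
  interpret cring R by fact
  interpret Q: ideal Q R
    using Q by (simp add: absorbing_ideal_def proper_ideal_def)
  have closed: "b j \<in> carrier R" if "j \<in> {1..k + 2}" for j
    using b that by blast
  define c where "c = b(k + 1 := b (k + 1) \<otimes> b (k + 2))"
  have c: "c \<in> {1..k + 1} \<rightarrow> carrier R"
    using closed by (auto simp: c_def)
  \<comment> \<open>As long as the merged factor is kept, merging does not change the product.\<close>
  have c_prod: "(\<Otimes>j\<in>insert (k + 1) A. c j) = (\<Otimes>j\<in>insert (k + 2) (insert (k + 1) A). b j)"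
    if "A \<subseteq> {1..k}" for A
  proof -
    have fin: "finite A" and notin: "k + 1 \<notin> A" "k + 2 \<notin> A"
      using that finite_subset by fastforce+
    have bA: "b \<in> A \<rightarrow> carrier R"
      using that closed by fastforce
    have "(\<Otimes>j\<in>A. c j) = (\<Otimes>j\<in>A. b j)"
      by (rule finprod_cong') (use notin bA in \<open>auto simp: c_def\<close>)
    moreover have "c \<in> A \<rightarrow> carrier R" "c (k + 1) \<in> carrier R"
      using that c by fastforce+
    then have "(\<Otimes>j\<in>insert (k + 1) A. c j) = c (k + 1) \<otimes> (\<Otimes>j\<in>A. c j)"
      using fin notin by (intro finprod_insert)
    ultimately have "(\<Otimes>j\<in>insert (k + 1) A. c j) = b (k + 1) \<otimes> b (k + 2) \<otimes> (\<Otimes>j\<in>A. b j)"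
      by (simp add: c_def)
    then show ?thesis
      using fin notin bA closed by (simp add: m_ac)
  qed
  have "{1..k + 1} = insert (k + 1) {1..k}" "{1..k + 2} = insert (k + 2) (insert (k + 1) {1..k})"
    by auto
  then have "(\<Otimes>j\<in>{1..k + 1}. c j) \<in> Q"
    using prod c_prod[of "{1..k}"] by simp
  then obtain S where S: "S \<subseteq> {1..k + 1}" "card S = k" "(\<Otimes>j\<in>S. c j) \<in> Q"
    using Q c unfolding absorbing_ideal_def by blast
  have "card ({1..k + 1} - S) = 1"
    using S by (simp add: card_Diff_subset finite_subset)
  then obtain i where "{1..k + 1} - S = {i}"
    by (auto simp: card_1_singleton_iff)
  with S(1) have i: "i \<in> {1..k + 1}" "S = {1..k + 1} - {i}"
    by blast+
  have "(\<Otimes>j\<in>{1..k + 2} - {i}. b j) \<in> Q"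
  proof (cases "i = k + 1")
    case True
    have "S = {1..k}"
      using i True by auto
    moreover have "(\<Otimes>j\<in>{1..k}. c j) = (\<Otimes>j\<in>{1..k}. b j)"
      by (rule finprod_cong') (use closed in \<open>auto simp: c_def\<close>)
    ultimately have "b (k + 2) \<otimes> (\<Otimes>j\<in>{1..k}. b j) \<in> Q"
      using S(3) closed Q.I_l_closed by simp
    moreover have "{1..k + 2} - {i} = insert (k + 2) {1..k}"
      using True by auto
    moreover have "b \<in> {1..k} \<rightarrow> carrier R"
      using closed by simp
    ultimately show ?thesis
      using closed by simp
  next
    case False
    then have "S = insert (k + 1) ({1..k} - {i})"
      "{1..k + 2} - {i} = insert (k + 2) (insert (k + 1) ({1..k} - {i}))"
      using i by auto
    then show ?thesis
      using S(3) c_prod[of "{1..k} - {i}"] by simp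
  qed
  with i(1) show ?thesis by blast
qed

theorem proposition2p6:
  fixes R (structure) and I P :: "'a set" and n :: nat
  assumes "cring R" and "\<one> \<noteq> \<zero>"
    and "proper_ideal I R"
    and "n \<ge> 2"
    and "ideal P R"
    and "radical R (I \<cdot> radical R P) \<subseteq> I \<cdot> P"
    and "absorbing_ideal (n - 1) (radical R P) R"
  shows "absorbing_primary_ideal n I P R"
proof -
  have sub: "P \<subseteq> radical R P"
    using \<open>ideal P R\<close> by (rule subset_radical)
  have "radical R P \<subseteq> carrier R"
    by (auto simp: radical_def)
  moreover have "radical R P \<noteq> carrier R"
    using assms(7) by (simp add: absorbing_ideal_def proper_ideal_def)
  ultimately have "proper_ideal P R"
    using sub \<open>ideal P R\<close> by (auto simp: proper_ideal_def)
  moreover have "\<exists>i \<in> {1..n}. (\<Otimes>j\<in>{1..n + 1} - {i}. b j) \<in> radical R P"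
    if "b \<in> {1..n + 1} \<rightarrow> carrier R" "(\<Otimes>j\<in>{1..n + 1}. b j) \<in> P" for b
  proof -
    have n: "n - 1 + 1 = n" "n - 1 + 2 = n + 1"
      using \<open>n \<ge> 2\<close> by simp_all
    show ?thesis
      using absorbing_ideal_omit_not_last[OF assms(1,7), of b, unfolded n] that sub by blast
  qed
  ultimately show ?thesis
    unfolding absorbing_primary_ideal_def by blast
qed

end
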